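(* Let $k$ be a field, $n\ge 1$, and let $Q$ be the $n$-Kronecker quiver. For every positive imaginary root $(x,y)$ for $Q$ there exist at least $n$ pairwise non-isomorphic finite-dimensional $kQ$-modules that are tree modules and have dimension vector $(x,y)$.
   Context: The $n$-Kronecker quiver $Q$ has two vertices, a source $1$ and a sink $2$, and $n$ arrows $\alpha_1,\dots,\alpha_n\colon 1\to 2$. A finite-dimensional $kQ$-module is a representation $M=(M_1,M_2;M_{\alpha_1},\dots,M_{\alpha_n})$ with finite-dimensional $k$-vector spaces $M_1,M_2$ and linear maps $M_{\alpha_i}\colon M_1\to M_2$; its dimension vector is $(\dim M_1,\dim M_2)$. The root system of $Q$ consists of the vectors $(x,y)\in\mathbb Z^2$ with $x^2+y^2-nxy\le 1$; a root is positive if $x,y\ge 0$ and $(x,y)\ne(0,0)$; roots with $x^2+y^2-nxy=1$ are real, the other roots are imaginary. For a representation $M$ of a quiver, its total dimension $d$ is the sum of the dimensions of all its vector spaces; an indecomposable representation $M$ of total dimension $d$ is a tree module if one can choose bases of all the vector spaces such that the matrices of all the arrow maps together have exactly $d-1$ non-zero entries (equivalently, the coefficient quiver is a tree). *)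

theory Defs
  imports "Jordan_Normal_Form.Matrix"
begin

text \<open>A finite-dimensional representation of the n-Kronecker quiver with dimension
vector (x,y) over a field: after choosing bases, M_1 = k^x, M_2 = k^y and the arrow
maps are given by matrices A i (y rows, x columns), i < n.\<close>

definition kronecker_rep :: "nat \<Rightarrow> nat \<Rightarrow> nat \<Rightarrow> (nat \<Rightarrow> 'a::field mat) \<Rightarrow> bool" where
  "kronecker_rep n x y A \<longleftrightarrow> (\<forall>i<n. A i \<in> carrier_mat y x)"

definition rep_iso :: "nat \<Rightarrow> nat \<Rightarrow> nat \<Rightarrow> (nat \<Rightarrow> 'a::field mat) \<Rightarrow> (nat \<Rightarrow> 'a mat) \<Rightarrow> bool" where
  "rep_iso n x y A B \<longleftrightarrow> (\<exists>P Q. P \<in> carrier_mat x x \<and> Q \<in> carrier_mat y y \<and>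
      invertible_mat P \<and> invertible_mat Q \<and> (\<forall>i<n. Q * A i = B i * P))"

definition rep_dsum :: "nat \<Rightarrow> nat \<Rightarrow> nat \<Rightarrow> nat \<Rightarrow> (nat \<Rightarrow> 'a::field mat) \<Rightarrow> (nat \<Rightarrow> 'a mat) \<Rightarrow> (nat \<Rightarrow> 'a mat)" where
  "rep_dsum x1 y1 x2 y2 B C = (\<lambda>i. four_block_mat (B i) (0\<^sub>m y1 x2) (0\<^sub>m y2 x1) (C i))"

definition rep_indecomposable :: "nat \<Rightarrow> nat \<Rightarrow> nat \<Rightarrow> (nat \<Rightarrow> 'a::field mat) \<Rightarrow> bool" where
  "rep_indecomposable n x y A \<longleftrightarrow> 0 < x + y \<and>
    \<not> (\<exists>x1 y1 x2 y2 B C. x1 + x2 = x \<and> y1 + y2 = y \<and> 0 < x1 + y1 \<and> 0 < x2 + y2 \<and>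
        kronecker_rep n x1 y1 B \<and> kronecker_rep n x2 y2 C \<and>
        rep_iso n x y A (rep_dsum x1 y1 x2 y2 B C))"

definition nonzero_entries :: "nat \<Rightarrow> nat \<Rightarrow> nat \<Rightarrow> (nat \<Rightarrow> 'a::field mat) \<Rightarrow> nat" where
  "nonzero_entries n x y B = card {(i, r, c). i < n \<and> r < y \<and> c < x \<and> B i $$ (r, c) \<noteq> 0}"

text \<open>Tree module: indecomposable, and for some choice of bases (i.e. some isomorphic
matrix representation) the matrices have exactly d - 1 nonzero entries, d = x + y.\<close>
definition tree_module :: "nat \<Rightarrow> nat \<Rightarrow> nat \<Rightarrow> (nat \<Rightarrow> 'a::field mat) \<Rightarrow> bool" where
  "tree_module n x y A \<longleftrightarrow> kronecker_rep n x y A \<and> rep_indecomposable n x y A \<and>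
    (\<exists>B. kronecker_rep n x y B \<and> rep_iso n x y A B \<and> nonzero_entries n x y B = x + y - 1)"

definition kronecker_root :: "nat \<Rightarrow> int \<Rightarrow> int \<Rightarrow> bool" where
  "kronecker_root n x y \<longleftrightarrow> x^2 + y^2 - int n * x * y \<le> 1"

definition positive_imaginary_root :: "nat \<Rightarrow> int \<Rightarrow> int \<Rightarrow> bool" where
  "positive_imaginary_root n x y \<longleftrightarrow> kronecker_root n x y \<and> x \<ge> 0 \<and> y \<ge> 0 \<and> (x, y) \<noteq> (0, 0)
     \<and> x^2 + y^2 - int n * x * y \<noteq> 1"

end

(* An imaginary root has x, y > 0 and n >= 2, and by transposing all matrices we may assume x <= y.

   If y <= (n - 1) x, take the thin module whose colour-0 arrow is the inclusion of k^x into k^y,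
   whose colour-1 arrow is a nilpotent Jordan block into the same x coordinates, and whose other
   y - x sinks are pendant, reached by the colours >= 2. An endomorphism is determined by a matrix
   commuting with the Jordan block, so it is idempotent only if it is 0 or 1. The colour 0 acts
   injectively and the colour 1 does not, so permuting the arrows gives n non-isomorphic modules.

   If y > (n - 1) x, put z = n x - y <= x. Then (z, x) is again an imaginary root, and a module N of
   dimension vector (z, x) with injective k^z -> k^x (x) k^n yields M = coker of dimension vector
   (x, y). Homomorphisms of M lift to N, so M inherits indecomposability and non-isomorphism. The
   count of nonzero entries also survives provided that for some colour i the matrix A_i contains
   an identity matrix on z of its rows: these z rows serve as pivots, the remaining n x - z rows
   index a basis of the cokernel, and the cokernel has the same property for every colour other
   than i, so the step can be iterated. *)

theory Submission
  imports Defs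
begin

section \<open>Matrices over arbitrary index sets\<close>

text \<open>Matrices are plain functions with the index sets supplied separately, so that pairs
  (colour, coordinate) can index rows and \<open>mm\<close> is associative without side conditions.
  Values outside the index sets are arbitrary, hence \<open>meq\<close> in place of
  equality.\<close>

definition mm :: "'k set \<Rightarrow> ('i \<Rightarrow> 'k \<Rightarrow> 'a::field) \<Rightarrow> ('k \<Rightarrow> 'j \<Rightarrow> 'a) \<Rightarrow> 'i \<Rightarrow> 'j \<Rightarrow> 'a" where
  "mm K f g = (\<lambda>i j. \<Sum>k\<in>K. f i k * g k j)"

definition meq :: "'i set \<Rightarrow> 'j set \<Rightarrow> ('i \<Rightarrow> 'j \<Rightarrow> 'a) \<Rightarrow> ('i \<Rightarrow> 'j \<Rightarrow> 'a) \<Rightarrow> bool" where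
  "meq I J f g \<longleftrightarrow> (\<forall>i\<in>I. \<forall>j\<in>J. f i j = g i j)"

definition one_m :: "'i \<Rightarrow> 'i \<Rightarrow> 'a::field" where
  "one_m = (\<lambda>i j. of_bool (i = j))"

definition zero_m :: "'i \<Rightarrow> 'j \<Rightarrow> 'a::field" where
  "zero_m = (\<lambda>i j. 0)"

lemma meq_refl [simp]: "meq I J f f"
  by (simp add: meq_def)

lemma meq_sym: "meq I J f g \<Longrightarrow> meq I J g f"
  by (simp add: meq_def)

lemma meq_trans [trans]: "meq I J f g \<Longrightarrow> meq I J g h \<Longrightarrow> meq I J f h"
  by (simp add: meq_def)

lemma mm_cong: "meq I K f f' \<Longrightarrow> meq K J g g' \<Longrightarrow> meq I J (mm K f g) (mm K f' g')"
  by (auto simp: meq_def mm_def intro!: sum.cong)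

lemma mm_assoc: "mm J (mm K f g) h = mm K f (mm J g h)"
proof (intro ext)
  fix i l
  have "mm J (mm K f g) h i l = (\<Sum>j\<in>J. \<Sum>k\<in>K. f i k * g k j * h j l)"
    by (simp add: mm_def sum_distrib_right)
  also have "\<dots> = (\<Sum>k\<in>K. \<Sum>j\<in>J. f i k * g k j * h j l)"
    by (rule sum.swap)
  also have "\<dots> = mm K f (mm J g h) i l"
    by (simp add: mm_def sum_distrib_left mult.assoc)
  finally show "mm J (mm K f g) h i l = mm K f (mm J g h) i l" .
qed

lemma mm_one_left: "finite I \<Longrightarrow> meq I J (mm I one_m f) f"
  by (simp add: meq_def mm_def one_m_def if_distrib[of "\<lambda>a. a * _"] cong: if_cong)

lemma mm_one_right: "finite J \<Longrightarrow> meq I J (mm J f one_m) f"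
  by (simp add: meq_def mm_def one_m_def if_distrib[of "\<lambda>a. _ * a"] cong: if_cong)

lemma mm_zero_left [simp]: "mm K zero_m g = zero_m"
  by (simp add: mm_def zero_m_def)

lemma mm_zero_right [simp]: "mm K f zero_m = zero_m"
  by (simp add: mm_def zero_m_def)

section \<open>Homomorphisms of Kronecker representations\<close>

definition khom :: "nat \<Rightarrow> nat \<Rightarrow> nat \<Rightarrow> (nat \<Rightarrow> nat \<Rightarrow> nat \<Rightarrow> 'a::field) \<Rightarrow> (nat \<Rightarrow> nat \<Rightarrow> nat \<Rightarrow> 'a)
    \<Rightarrow> (nat \<Rightarrow> nat \<Rightarrow> 'a) \<Rightarrow> (nat \<Rightarrow> nat \<Rightarrow> 'a) \<Rightarrow> bool" where
  "khom n x y A B P Q \<longleftrightarrow> (\<forall>i<n. meq {..<y} {..<x} (mm {..<y} Q (A i)) (mm {..<x} (B i) P))"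

definition inverse_m :: "nat \<Rightarrow> (nat \<Rightarrow> nat \<Rightarrow> 'a::field) \<Rightarrow> (nat \<Rightarrow> nat \<Rightarrow> 'a) \<Rightarrow> bool" where
  "inverse_m x P P' \<longleftrightarrow> meq {..<x} {..<x} (mm {..<x} P P') one_m \<and> meq {..<x} {..<x} (mm {..<x} P' P) one_m"

definition kiso :: "nat \<Rightarrow> nat \<Rightarrow> nat \<Rightarrow> (nat \<Rightarrow> nat \<Rightarrow> nat \<Rightarrow> 'a::field) \<Rightarrow> (nat \<Rightarrow> nat \<Rightarrow> nat \<Rightarrow> 'a) \<Rightarrow> bool" where
  "kiso n x y A B \<longleftrightarrow> (\<exists>P Q P' Q'. khom n x y A B P Q \<and> khom n x y B A P' Q' \<and>
     inverse_m x P P' \<and> inverse_m y Q Q')"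

definition idem_m :: "nat \<Rightarrow> (nat \<Rightarrow> nat \<Rightarrow> 'a::field) \<Rightarrow> bool" where
  "idem_m x P \<longleftrightarrow> meq {..<x} {..<x} (mm {..<x} P P) P"

text \<open>Indecomposability in terms of the endomorphism ring: no idempotents but 0 and 1. In this
  form it transfers along homomorphism lifts without mentioning direct sums.\<close>

definition idem_trivial :: "nat \<Rightarrow> nat \<Rightarrow> nat \<Rightarrow> (nat \<Rightarrow> nat \<Rightarrow> nat \<Rightarrow> 'a::field) \<Rightarrow> bool" where
  "idem_trivial n x y A \<longleftrightarrow> (\<forall>P Q. khom n x y A A P Q \<longrightarrow> idem_m x P \<longrightarrow> idem_m y Q \<longrightarrow>
     meq {..<x} {..<x} P zero_m \<and> meq {..<y} {..<y} Q zero_m \<or>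
     meq {..<x} {..<x} P one_m \<and> meq {..<y} {..<y} Q one_m)"

lemma kiso_sym: "kiso n x y A B \<Longrightarrow> kiso n x y B A"
  unfolding kiso_def inverse_m_def by blast

section \<open>Reflection\<close>

(* stack A is the map k^z -> k^n (x) k^x of a representation of dimension vector (z, x), costack M
   the map k^n (x) k^x -> k^y of one of dimension vector (x, y), and tens P is 1 (x) P. *)
definition stack :: "(nat \<Rightarrow> nat \<Rightarrow> nat \<Rightarrow> 'a) \<Rightarrow> nat \<times> nat \<Rightarrow> nat \<Rightarrow> 'a" where
  "stack A = (\<lambda>p c. A (fst p) (snd p) c)"

definition costack :: "(nat \<Rightarrow> nat \<Rightarrow> nat \<Rightarrow> 'a) \<Rightarrow> nat \<Rightarrow> nat \<times> nat \<Rightarrow> 'a" where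
  "costack M = (\<lambda>s p. M (fst p) s (snd p))"

definition tens :: "(nat \<Rightarrow> nat \<Rightarrow> 'a::field) \<Rightarrow> nat \<times> nat \<Rightarrow> nat \<times> nat \<Rightarrow> 'a" where
  "tens P = (\<lambda>p q. of_bool (fst p = fst q) * P (snd p) (snd q))"

lemma sum_tens_left:
  fixes i n x :: nat
  assumes "i < n"
  shows "(\<Sum>p\<in>{..<n}\<times>{..<x}. of_bool (i = fst p) * f p) = (\<Sum>b<x. f (i, b) :: 'a::field)"
proof -
  have "(\<Sum>p\<in>{..<n}\<times>{..<x}. of_bool (i = fst p) * f p) = (\<Sum>j<n. \<Sum>b<x. of_bool (i = j) * f (j, b))"
    by (simp only: sum.cartesian_product case_prod_unfold prod.collapse)
  also have "\<dots> = (\<Sum>j<n. of_bool (i = j) * (\<Sum>b<x. f (j, b)))"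
    by (simp add: sum_distrib_left)
  also have "\<dots> = (\<Sum>b<x. f (i, b))"
    using assms by (subst sum.remove[of _ i]) auto
  finally show ?thesis .
qed

lemma mm_tens_stack:
  "i < n \<Longrightarrow> mm ({..<n} \<times> {..<x}) (tens P) (stack A) (i, b) c = mm {..<x} P (A i) b c"
  using sum_tens_left[where i = i and n = n and x = x and f = "\<lambda>p. P b (snd p) * A (fst p) (snd p) c"]
  by (simp add: mm_def tens_def stack_def mult.assoc)

lemma mm_costack_tens:
  "i < n \<Longrightarrow> mm ({..<n} \<times> {..<x}) (costack M) (tens P) s (i, b) = mm {..<x} (M i) P s b"
  using sum_tens_left[where i = i and n = n and x = x and f = "\<lambda>p. M (fst p) s (snd p) * P (snd p) b"]
  by (simp add: mm_def tens_def costack_def mult_ac eq_commute)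

lemma mm_tens_tens:
  "i < n \<Longrightarrow> mm ({..<n} \<times> {..<x}) (tens P) (tens P') (i, b) q = tens (mm {..<x} P P') (i, b) q"
  using sum_tens_left[where i = i and n = n and x = x and f = "\<lambda>p. P b (snd p) * (of_bool (fst p = fst q) * P' (snd p) (snd q))"]
  by (simp add: mm_def tens_def mult_ac sum_distrib_left)

lemma tens_cong: "meq {..<x} {..<x} P P' \<Longrightarrow> meq ({..<n} \<times> {..<x}) ({..<n} \<times> {..<x}) (tens P) (tens P')"
  by (auto simp: meq_def tens_def)

lemma tens_one: "tens one_m = one_m"
  by (auto simp: tens_def one_m_def fun_eq_iff)

text \<open>Turns the n commuting squares into one identity between maps into k^n (x) k^x, the
  middle term of the exact sequence, where the splittings can be applied.\<close>

lemma khom_stack: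
  "khom n z x A A' R P \<longleftrightarrow>
     meq ({..<n} \<times> {..<x}) {..<z} (mm ({..<n} \<times> {..<x}) (tens P) (stack A)) (mm {..<z} (stack A') R)"
proof -
  have "mm {..<z} (stack A') R (i, b) c = mm {..<z} (A' i) R b c" for i b c
    by (simp add: mm_def stack_def)
  then show ?thesis
    by (auto simp: khom_def meq_def mm_tens_stack)
qed

lemma khom_costack:
  "khom n x y M M' P Q \<longleftrightarrow>
     meq {..<y} ({..<n} \<times> {..<x}) (mm {..<y} Q (costack M)) (mm ({..<n} \<times> {..<x}) (costack M') (tens P))"
proof -
  have "mm {..<y} Q (costack M) s (i, b) = mm {..<y} Q (M i) s b" for i b s
    by (simp add: mm_def costack_def)
  then show ?thesis
    by (auto simp: khom_def meq_def mm_costack_tens)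
qed

(* The sequence 0 -> k^z -> k^n (x) k^x -> k^y -> 0 is exact, with splittings L and S. *)
definition split_exact :: "nat \<Rightarrow> nat \<Rightarrow> nat \<Rightarrow> nat \<Rightarrow> (nat \<Rightarrow> nat \<Rightarrow> nat \<Rightarrow> 'a::field) \<Rightarrow> (nat \<Rightarrow> nat \<Rightarrow> nat \<Rightarrow> 'a)
    \<Rightarrow> (nat \<Rightarrow> nat \<times> nat \<Rightarrow> 'a) \<Rightarrow> (nat \<times> nat \<Rightarrow> nat \<Rightarrow> 'a) \<Rightarrow> bool" where
  "split_exact n z x y A M L S \<longleftrightarrow>
     (let I = {..<n} \<times> {..<x} in
      meq {..<z} {..<z} (mm I L (stack A)) one_m \<and>
      meq {..<y} {..<z} (mm I (costack M) (stack A)) zero_m \<and>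
      meq {..<y} {..<y} (mm I (costack M) S) one_m \<and>
      meq I I (\<lambda>p q. mm {..<z} (stack A) L p q + mm {..<y} S (costack M) p q) one_m)"

section \<open>Lifting homomorphisms through the exact sequence\<close>

lemma mm_add_left: "mm K (\<lambda>i k. f i k + f' i k) g = (\<lambda>i j. mm K f g i j + mm K f' g i j)"
  by (simp add: mm_def sum.distrib algebra_simps)

text \<open>The only candidate for the lift R of P: it must satisfy \<open>stack A'\<close> R = (1
  (x) P) \<open>stack A\<close>, and \<open>L'\<close> is a left inverse of
  \<open>stack A'\<close>.\<close>

definition reflect_map :: "nat \<Rightarrow> nat \<Rightarrow> (nat \<Rightarrow> nat \<times> nat \<Rightarrow> 'a::field) \<Rightarrow> (nat \<Rightarrow> nat \<Rightarrow> nat \<Rightarrow> 'a) \<Rightarrow> 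
    (nat \<Rightarrow> nat \<Rightarrow> 'a) \<Rightarrow> nat \<Rightarrow> nat \<Rightarrow> 'a" where
  "reflect_map n x L' A P = mm ({..<n} \<times> {..<x}) L' (mm ({..<n} \<times> {..<x}) (tens P) (stack A))"

text \<open>The composite \<open>costack M'\<close> (1 (x) P) \<open>stack A\<close> equals Q
  \<open>costack M\<close> \<open>stack A\<close>, which is 0 by exactness. So (1 (x) P)
  \<open>stack A\<close> factors through the image of \<open>stack A'\<close>.\<close>

lemma reflect_hom:
  assumes s: "split_exact n z x y A M L S" and s': "split_exact n z x y A' M' L' S'"
    and h: "khom n x y M M' P Q"
  shows "khom n z x A A' (reflect_map n x L' A P) P"
proof -
  define I where "I = {..<n} \<times> {..<x}"
  have fI: "finite I" by (simp add: I_def)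
  define T where "T = mm I (tens P) (stack A)"
  have "meq {..<y} {..<z} (mm I (costack M') T) (mm I (mm {..<y} Q (costack M)) (stack A))"
    unfolding T_def mm_assoc[symmetric] using h by (intro mm_cong) (auto simp: khom_costack I_def meq_sym)
  also have "meq {..<y} {..<z} \<dots> (mm {..<y} Q zero_m)"
    unfolding mm_assoc using s by (intro mm_cong) (auto simp: split_exact_def Let_def I_def)
  finally have 0: "meq {..<y} {..<z} (mm I (costack M') T) zero_m" by simp
  have "meq I {..<z} T (mm I one_m T)"
    by (rule meq_sym[OF mm_one_left[OF fI]])
  \<comment> \<open>Decompose the identity of the middle term by the splitting of the second
    sequence; the summand through \<open>costack M'\<close> dies by \<open>0\<close>.\<close>
  also have "meq I {..<z} \<dots> (mm I (\<lambda>p q. mm {..<z} (stack A') L' p q + mm {..<y} S' (costack M') p q) T)"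
    using s' by (intro mm_cong meq_refl) (auto simp: split_exact_def Let_def I_def meq_sym)
  also have "\<dots> = (\<lambda>i j. mm {..<z} (stack A') (mm I L' T) i j + mm {..<y} S' (mm I (costack M') T) i j)"
    by (simp add: mm_add_left mm_assoc)
  also have "meq I {..<z} \<dots> (mm {..<z} (stack A') (mm I L' T))"
    using mm_cong[OF meq_refl 0, of I S'] by (auto simp: meq_def) (simp add: zero_m_def)
  finally show ?thesis
    by (simp add: khom_stack reflect_map_def T_def I_def)
qed

lemma split_cancel:
  assumes s: "split_exact n z x y A M L S"
    and e: "meq ({..<n} \<times> {..<x}) {..<z} (mm {..<z} (stack A) R) (mm {..<z} (stack A) R')"
  shows "meq {..<z} {..<z} R R'"
proof -
  define I where "I = {..<n} \<times> {..<x}"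
  have l: "meq {..<z} {..<z} (mm I L (stack A)) one_m"
    using s by (simp add: split_exact_def Let_def I_def)
  have l2: "meq {..<z} {..<z} (mm I L (mm {..<z} (stack A) R)) R" for R
    using meq_trans[OF mm_cong[OF l meq_refl] mm_one_left] by (simp add: mm_assoc)
  have "meq {..<z} {..<z} (mm I L (mm {..<z} (stack A) R)) (mm I L (mm {..<z} (stack A) R'))"
    using mm_cong[OF meq_refl e] by (simp add: I_def)
  then show ?thesis
    using l2 meq_sym meq_trans by blast
qed

text \<open>Since \<open>stack A''\<close> is injective, the lift is determined by P. Hence
  relations among the P pass to the lifts, both P' P = 1 for isomorphisms and P P = P for
  idempotents.\<close>

lemma khom_comp_eq:
  assumes s: "split_exact n z x y A'' M L S"
    and h1: "khom n z x A A' R P" and h2: "khom n z x A' A'' R' P'" and h3: "khom n z x A A'' R'' P''"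
    and e: "meq {..<x} {..<x} (mm {..<x} P' P) P''"
  shows "meq {..<z} {..<z} (mm {..<z} R' R) R''"
proof (rule split_cancel[OF s])
  define I where "I = {..<n} \<times> {..<x}"
  note h = h1[unfolded khom_stack, folded I_def] h2[unfolded khom_stack, folded I_def] 
     h3[unfolded khom_stack, folded I_def]
  have "meq I {..<z} (mm {..<z} (stack A'') (mm {..<z} R' R)) (mm {..<z} (mm I (tens P') (stack A')) R)"
    unfolding mm_assoc[symmetric] by (intro mm_cong meq_refl meq_sym[OF h(2)])
  also have "meq I {..<z} \<dots> (mm I (tens P') (mm I (tens P) (stack A)))"
    unfolding mm_assoc by (intro mm_cong meq_refl meq_sym[OF h(1)])
  also have "\<dots> = mm I (mm I (tens P') (tens P)) (stack A)"
    by (simp add: mm_assoc)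
  also have "meq I {..<z} \<dots> (mm I (tens (mm {..<x} P' P)) (stack A))"
    by (intro mm_cong meq_refl) (auto simp: meq_def I_def mm_tens_tens)
  also have "meq I {..<z} \<dots> (mm I (tens P'') (stack A))"
    unfolding I_def by (intro mm_cong meq_refl tens_cong e)
  also note h(3)
  finally show "meq ({..<n} \<times> {..<x}) {..<z} (mm {..<z} (stack A'') (mm {..<z} R' R)) (mm {..<z} (stack A'') R'')"
    by (simp add: I_def)
qed

lemma khom_one: "khom n x y A A one_m one_m"
  unfolding khom_def
  by (auto intro: meq_trans[OF mm_one_left meq_sym[OF mm_one_right]])

lemma reflect_iso:
  assumes s: "split_exact n z x y A M L S" and s': "split_exact n z x y A' M' L' S'"
    and i: "kiso n x y M M'"
  shows "kiso n z x A A'"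
proof -
  obtain P Q P' Q' where h: "khom n x y M M' P Q" "khom n x y M' M P' Q'"
    and inv: "inverse_m x P P'" "inverse_m y Q Q'"
    using i unfolding kiso_def by blast
  define R where "R = reflect_map n x L' A P"
  define R' where "R' = reflect_map n x L A' P'"
  have k: "khom n z x A A' R P" "khom n z x A' A R' P'"
    unfolding R_def R'_def by (rule reflect_hom[OF s s' h(1)] reflect_hom[OF s' s h(2)])+
  have "inverse_m z R R'"
    using khom_comp_eq[OF s' k(2) k(1) khom_one] khom_comp_eq[OF s k(1) k(2) khom_one] inv
    by (simp add: inverse_m_def)
  with k inv show ?thesis unfolding kiso_def by blast
qed

text \<open>An idempotent (P, Q) of M lifts to an idempotent (R, P) of A, so P is 0 or 1. As
  \<open>costack M\<close> is surjective, P determines Q.\<close>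

lemma reflect_idem_trivial:
  assumes s: "split_exact n z x y A M L S" and t: "idem_trivial n z x A"
  shows "idem_trivial n x y M"
  unfolding idem_trivial_def
proof (intro allI impI)
  fix P Q :: "nat \<Rightarrow> nat \<Rightarrow> 'a"
  assume h: "khom n x y M M P Q" and P: "idem_m x P" and Q: "idem_m y Q"
  define I where "I = {..<n} \<times> {..<x}"
  define R where "R = reflect_map n x L A P"
  have k: "khom n z x A A R P"
    unfolding R_def by (rule reflect_hom[OF s s h])
  have "idem_m z R"
    using khom_comp_eq[OF s k k k] P by (simp add: idem_m_def)
  then have *: "meq {..<x} {..<x} P zero_m \<or> meq {..<x} {..<x} P one_m"
    using t k P unfolding idem_trivial_def by blast
  have gs: "meq {..<y} {..<y} (mm I (costack M) S) one_m"
    using s by (simp add: split_exact_def Let_def I_def)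
  \<comment> \<open>The section S of \<open>costack M\<close> expresses Q as
    \<open>costack M\<close> (1 (x) P) S.\<close>
  have "meq {..<y} {..<y} Q (mm {..<y} Q one_m)"
    by (intro meq_sym[OF mm_one_right]) auto
  also have "meq {..<y} {..<y} \<dots> (mm I (mm {..<y} Q (costack M)) S)"
    unfolding mm_assoc by (intro mm_cong meq_refl meq_sym[OF gs])
  also have "meq {..<y} {..<y} \<dots> (mm I (mm I (costack M) (tens P)) S)"
    using h by (intro mm_cong meq_refl) (simp add: khom_costack I_def)
  finally have q: "meq {..<y} {..<y} Q (mm I (costack M) (mm I (tens P) S))"
    by (simp add: mm_assoc)
  have tz: "(tens zero_m :: _ \<Rightarrow> _ \<Rightarrow> 'a) = zero_m"
    by (simp add: tens_def zero_m_def)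
  have cong: "meq {..<y} {..<y} (mm I (costack M) (mm I (tens P) S)) (mm I (costack M) (mm I (tens P') S))"
    if "meq {..<x} {..<x} P P'" for P'
    using tens_cong[OF that] by (intro mm_cong meq_refl) (auto simp: I_def)
  have "meq {..<y} {..<y} Q zero_m" if "meq {..<x} {..<x} P zero_m"
    using meq_trans[OF q cong[OF that]] by (simp add: tz)
  moreover have "meq {..<y} {..<y} Q one_m" if "meq {..<x} {..<x} P one_m"
  proof -
    have "meq {..<y} {..<y} Q (mm I (costack M) (mm I one_m S))"
      using meq_trans[OF q cong[OF that]] by (simp add: tens_one)
    also have "meq {..<y} {..<y} \<dots> (mm I (costack M) S)"
      by (intro mm_cong meq_refl mm_one_left) (simp add: I_def)
    also note gs
    finally show ?thesis .
  qed
  ultimately show "meq {..<x} {..<x} P zero_m \<and> meq {..<y} {..<y} Q zero_m \<or>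
     meq {..<x} {..<x} P one_m \<and> meq {..<y} {..<y} Q one_m"
    using * by blast
qed

section \<open>The tree property under reflection\<close>

text \<open>The arrows of the coefficient quiver.\<close>

definition edges :: "nat \<Rightarrow> nat \<Rightarrow> nat \<Rightarrow> (nat \<Rightarrow> nat \<Rightarrow> nat \<Rightarrow> 'a::zero) \<Rightarrow> (nat \<times> nat \<times> nat) set" where
  "edges n x y A = {(i, r, c). i < n \<and> r < y \<and> c < x \<and> A i r c \<noteq> 0}"

text \<open>At row \<open>p c\<close> the only arrow of colour i comes from c. The entries force p
  to be injective, so projecting to these rows is a left inverse of the stacked map.\<close>

definition pivoted :: "nat \<Rightarrow> nat \<Rightarrow> (nat \<Rightarrow> nat \<Rightarrow> nat \<Rightarrow> 'a::field) \<Rightarrow> nat \<Rightarrow> bool" where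
  "pivoted x y A i \<longleftrightarrow> (\<exists>p. \<forall>c<x. p c < y \<and> (\<forall>c'<x. A i (p c) c' = of_bool (c = c')))"

lemma sum_of_bool_eq: "finite I \<Longrightarrow> a \<in> I \<Longrightarrow> (\<Sum>q\<in>I. of_bool (q = a) * g q) = (g a :: 'a::field)"
  by (subst sum.remove[of _ a]) auto

text \<open>Gaussian elimination with the pivots. The z pivot entries of A are traded for y identity
  entries of M, and every other nonzero entry survives up to sign; so a tree stays a tree.\<close>

lemma reflect_exists:
  fixes A :: "nat \<Rightarrow> nat \<Rightarrow> nat \<Rightarrow> 'a::field"
  assumes pv: "pivoted z x A i0" and i0: "i0 < n" and i1: "i1 < n" "i1 \<noteq> i0" 
    and dim: "y + z = n * x" and x: "0 < x"
    and tree: "card (edges n z x A) = z + x - 1"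
  shows "\<exists>M L S. split_exact n z x y A M L S \<and> card (edges n x y M) = x + y - 1 \<and> pivoted x y M i1"
proof -
  obtain p where p: "\<And>c. c < z \<Longrightarrow> p c < x" 
      "\<And>c c'. c < z \<Longrightarrow> c' < z \<Longrightarrow> A i0 (p c) c' = of_bool (c = c')"
    using pv unfolding pivoted_def by blast
  have pinj: "c = c'" if "p c = p c'" "c < z" "c' < z" for c c'
  proof (rule ccontr)
    assume "c \<noteq> c'"
    then have "A i0 (p c) c = 1" "A i0 (p c') c = 0"
      using p(2) that(2,3) by simp_all
    then show False using that by simp
  qed
  define I where "I = {..<n} \<times> {..<x}"
  define v where "v c = (i0, p c)" for c
  define V where "V = v ` {..<z}"
  have fI: "finite I" by (simp add: I_def)
  have vI: "v c \<in> I" if "c < z" for c using p that i0 by (auto simp: v_def I_def)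
  have vinj: "inj_on v {..<z}" using pinj by (auto simp: inj_on_def v_def)
  have Av: "stack A (v c) c' = of_bool (c = c')" if "c < z" "c' < z" for c c'
    using p that by (simp add: stack_def v_def)
  have VI: "V \<subseteq> I" using vI by (auto simp: V_def)
  \<comment> \<open>V is the set of pivot coordinates. The remaining n x - z = y coordinates are
    enumerated by h and index a basis of the cokernel.\<close>
  have "card (I - V) = y"
    using dim VI fI vinj by (subst card_Diff_subset) (auto simp: V_def card_image I_def dest: finite_subset)
  then obtain h where h: "bij_betw h {..<y} (I - V)"
    using fI ex_bij_betw_nat_finite[of "I - V"] by (auto simp: atLeast0LessThan)
  have hI: "h s \<in> I" "h s \<notin> V" if "s < y" for s
    using h that by (auto simp: bij_betw_def)
  have hinj: "h s = h s' \<longleftrightarrow> s = s'" if "s < y" "s' < y" for s s'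
    using h that by (auto simp: bij_betw_def inj_on_def)
  have hsurj: "\<exists>s<y. h s = q" if "q \<in> I" "q \<notin> V" for q
    using h that by (force simp: bij_betw_def)
  have hv: "h s \<noteq> v c" if "s < y" "c < z" for s c
    using hI[OF that(1)] that by (auto simp: V_def)

  \<comment> \<open>L reads off the pivot coordinates and S includes the others. M projects to the
    non-pivot coordinates along the image of \<open>stack A\<close>: from the coordinate
    \<open>h s\<close> it subtracts that of the image vector with the same pivot
    coordinates.\<close>
  define L :: "nat \<Rightarrow> nat \<times> nat \<Rightarrow> 'a" where "L c q = of_bool (q = v c)" for c q
  define S :: "nat \<times> nat \<Rightarrow> nat \<Rightarrow> 'a" where "S q s = of_bool (h s = q)" for q s
  define M where "M j s b = of_bool (h s = (j, b)) - (\<Sum>c<z. stack A (h s) c * L c (j, b))" for j s b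
  have coM: "costack M s q = of_bool (q = h s) - (\<Sum>c<z. stack A (h s) c * L c q)" for s q
    by (cases q) (auto simp: costack_def M_def)
  have mL: "mm I L g c j = g (v c) j" if "c < z" for g :: "nat \<times> nat \<Rightarrow> nat \<Rightarrow> 'a" and c j
    unfolding mm_def L_def by (rule sum_of_bool_eq[OF fI vI[OF that]])
  have mM: "mm I (costack M) g s j = g (h s) j - (\<Sum>c<z. stack A (h s) c * g (v c) j)" 
    if "s < y" for g :: "nat \<times> nat \<Rightarrow> nat \<Rightarrow> 'a" and s j
  proof -
    have "mm I (costack M) g s j = (\<Sum>q\<in>I. of_bool (q = h s) * g q j) - mm I (mm {..<z} (\<lambda>s. stack A (h s)) L) g s j"
      by (simp add: mm_def coM left_diff_distrib sum_subtractf)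
    also have "\<dots> = g (h s) j - mm {..<z} (\<lambda>s. stack A (h s)) (mm I L g) s j"
      using sum_of_bool_eq[OF fI hI(1)[OF that]] by (simp add: mm_assoc)
    also have "mm {..<z} (\<lambda>s. stack A (h s)) (mm I L g) s j = (\<Sum>c<z. stack A (h s) c * g (v c) j)"
      by (simp add: mm_def[of "{..<z}"] mL)
    finally show ?thesis .
  qed
  have "meq {..<z} {..<z} (mm I L (stack A)) one_m"
    by (auto simp: meq_def mL Av one_m_def)
  moreover have "meq {..<y} {..<z} (mm I (costack M) (stack A)) zero_m"
  proof -
    have "(\<Sum>c<z. stack A (h s) c * stack A (v c) c') = stack A (h s) c'" if "c' < z" for s c'
      using sum_of_bool_eq[of "{..<z}" c' "stack A (h s)"] that by (simp add: Av mult.commute)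
    then show ?thesis by (auto simp: meq_def mM zero_m_def)
  qed
  moreover have "meq {..<y} {..<y} (mm I (costack M) S) one_m"
    by (auto simp: meq_def mM S_def hinj hv one_m_def)
  moreover have "meq I I (\<lambda>p q. mm {..<z} (stack A) L p q + mm {..<y} S (costack M) p q) one_m"
    unfolding meq_def
  proof (intro ballI)
    fix a q assume a: "a \<in> I" and q: "q \<in> I"
    \<comment> \<open>In a pivot row only the first summand is nonzero; in row \<open>h s0\<close>
      the second summand is the identity row minus the first summand.\<close>
    show "mm {..<z} (stack A) L a q + mm {..<y} S (costack M) a q = one_m a q"
    proof (cases "a \<in> V")
      case True
      then obtain c0 where c0: "c0 < z" "a = v c0" by (auto simp: V_def)
      have "mm {..<z} (stack A) L a q = (\<Sum>c<z. of_bool (c = c0) * L c q)"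
        unfolding mm_def using c0 by (intro sum.cong) (auto simp: Av)
      also have "\<dots> = L c0 q" using c0 by (intro sum_of_bool_eq) auto
      finally have "mm {..<z} (stack A) L a q = L c0 q" .
      moreover have "mm {..<y} S (costack M) a q = 0"
        unfolding mm_def S_def using c0 hv by simp
      ultimately show ?thesis by (auto simp: L_def one_m_def c0)
    next
      case False
      then obtain s0 where s0: "s0 < y" "a = h s0" using hsurj a by blast
      have "mm {..<y} S (costack M) a q = (\<Sum>s<y. of_bool (s = s0) * costack M s q)"
        unfolding mm_def S_def using s0 by (intro sum.cong) (auto simp: hinj)
      also have "\<dots> = costack M s0 q" using s0 by (intro sum_of_bool_eq) auto
      finally show ?thesis
        by (auto simp: coM mm_def s0 one_m_def)
    qed
  qed
  ultimately have split: "split_exact n z x y A M L S"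
    by (simp add: split_exact_def Let_def I_def)

  \<comment> \<open>The columns of M at pivot coordinates carry the negated non-pivot entries of A;
    all its other columns (\<open>Mu\<close>) are unit columns.\<close>
  have Mv: "M i0 s (p c) = - stack A (h s) c" if "s < y" "c < z" for s c
  proof -
    have "(\<Sum>c'<z. stack A (h s) c' * L c' (i0, p c)) = (\<Sum>c'<z. of_bool (c' = c) * stack A (h s) c')"
      using that vinj by (intro sum.cong) (auto simp: L_def v_def[symmetric] inj_on_def)
    also have "\<dots> = stack A (h s) c" using that by (intro sum_of_bool_eq) auto
    finally show ?thesis using hv[OF that] by (simp add: M_def v_def)
  qed
  have Mu: "M j s b = of_bool (h s = (j, b))" if "(j, b) \<notin> V" for j s b
    using that by (auto simp: M_def L_def V_def intro!: sum.neutral)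
  \<comment> \<open>W collects the non-pivot edges, common to both counts: A has z + card W edges
    and M has y + card W.\<close>
  define W where "W = {(s, c). s < y \<and> c < z \<and> stack A (h s) c \<noteq> 0}"
  have fW: "finite W" by (rule finite_subset[of _ "{..<y} \<times> {..<z}"]) (auto simp: W_def)
  have "edges n z x A = (\<lambda>c. (i0, p c, c)) ` {..<z} \<union> (\<lambda>(s, c). (fst (h s), snd (h s), c)) ` W"
    (is "_ = ?E1 \<union> ?E2")
  proof (intro equalityI subsetI)
    fix e assume "e \<in> edges n z x A"
    then obtain i r c where e: "e = (i, r, c)" "i < n" "r < x" "c < z" "A i r c \<noteq> 0" by (auto simp: edges_def)
    show "e \<in> ?E1 \<union> ?E2"
    proof (cases "(i, r) \<in> V")
      case True
      then obtain c0 where "c0 < z" "i = i0" "r = p c0" by (auto simp: V_def v_def)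
      with e p(2)[of c0 c] show ?thesis by auto
    next
      case False
      then obtain s where "s < y" "h s = (i, r)" using hsurj[of "(i, r)"] e by (auto simp: I_def)
      then have "(s, c) \<in> W" using e by (auto simp: W_def stack_def)
      then show ?thesis using e \<open>h s = (i, r)\<close> by force
    qed
  next
    fix e assume "e \<in> ?E1 \<union> ?E2"
    then show "e \<in> edges n z x A"
      using p i0 hI by (fastforce simp: edges_def W_def stack_def I_def)
  qed
  moreover have "?E1 \<inter> ?E2 = {}"
  proof -
    have False if "s < y" "c < z" "i0 = fst (h s)" "p c = snd (h s)" for s c
      using hv[OF that(1,2)] that by (auto simp: v_def)
    then show ?thesis by (auto simp: W_def)
  qed
  moreover have "card ?E1 = z"
    by (subst card_image) (auto simp: inj_on_def)
  moreover have "card ?E2 = card W"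
    by (rule card_image) (auto simp: inj_on_def W_def prod_eq_iff hinj[symmetric])
  ultimately have cW: "card (edges n z x A) = z + card W"
    using fW by (simp add: card_Un_disjoint)
  have "edges n x y M = (\<lambda>s. (fst (h s), s, snd (h s))) ` {..<y} \<union> (\<lambda>(s, c). (i0, s, p c)) ` W"
    (is "_ = ?F1 \<union> ?F2")
  proof (intro equalityI subsetI)
    fix e assume "e \<in> edges n x y M"
    then obtain j s b where e: "e = (j, s, b)" "j < n" "s < y" "b < x" "M j s b \<noteq> 0" by (auto simp: edges_def)
    show "e \<in> ?F1 \<union> ?F2"
    proof (cases "(j, b) \<in> V")
      case True
      then obtain c where c: "c < z" "j = i0" "b = p c" by (auto simp: V_def v_def)
      with e Mv have "(s, c) \<in> W" by (auto simp: W_def)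
      with c e show ?thesis by force
    next
      case False
      with e Mu have "h s = (j, b)" by (auto split: if_splits)
      with e show ?thesis by (auto intro!: image_eqI[of _ _ s])
    qed
  next
    fix e assume "e \<in> ?F1 \<union> ?F2"
    then show "e \<in> edges n x y M"
    proof
      assume "e \<in> ?F1"
      then obtain s where s: "s < y" "e = (fst (h s), s, snd (h s))" by auto
      then show ?thesis using hI[OF s(1)] Mu[of "fst (h s)" "snd (h s)" s] by (auto simp: edges_def I_def)
    next
      assume "e \<in> ?F2"
      then show ?thesis using p i0 by (auto simp: edges_def W_def Mv)
    qed
  qed
  moreover have "?F1 \<inter> ?F2 = {}"
  proof -
    have False if "s < y" "c < z" "i0 = fst (h s)" "p c = snd (h s)" for s c
      using hv[OF that(1,2)] that by (auto simp: v_def)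
    then show ?thesis by (fastforce simp: W_def)
  qed
  moreover have "card ?F1 = y"
    by (subst card_image) (auto simp: inj_on_def)
  moreover have "card ?F2 = card W"
    by (rule card_image) (auto simp: inj_on_def W_def pinj)
  ultimately have "card (edges n x y M) = y + card W"
    using fW by (simp add: card_Un_disjoint)
  then have "card (edges n x y M) = x + y - 1"
    using cW tree x by simp
  moreover have "pivoted x y M i1"
  proof -
    \<comment> \<open>All pivots have colour i0, so each \<open>(i1, b)\<close> is some
      \<open>h s\<close>. There M is a plain coordinate projection, and these rows are the new
      pivots.\<close>
    have iV: "(i1, b) \<notin> V" for b using i1 by (auto simp: V_def v_def)
    have "\<forall>b. \<exists>s. b < x \<longrightarrow> s < y \<and> h s = (i1, b)"
      using hsurj iV i1 by (auto simp: I_def)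
    then obtain k where "\<And>b. b < x \<Longrightarrow> k b < y \<and> h (k b) = (i1, b)" by metis
    then show ?thesis using Mu[OF iV] by (auto simp: pivoted_def intro!: exI[of _ k])
  qed
  ultimately show ?thesis using split by blast
qed

section \<open>Thin tree modules\<close>

text \<open>Colours 0 and 1 form a zigzag path through the x sources and the sinks below x. The
  pendant sink x + k hangs on source \<open>k mod x\<close> by colour \<open>2 + k div x\<close>, so
  that each pair of a source and a colour from 2 on serves at most one sink.\<close>

definition thin_tree :: "nat \<Rightarrow> nat \<Rightarrow> nat \<Rightarrow> nat \<Rightarrow> 'a::field" where
  "thin_tree x i r c = of_bool
     (if r < x then i = 0 \<and> r = c \<or> i = 1 \<and> c = Suc r
      else i = 2 + (r - x) div x \<and> c = (r - x) mod x)"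

text \<open>The n - 2 colours from 2 on offer (n - 2) x places, enough for the y - x pendant
  sinks.\<close>

lemma pendant_colour_less:
  fixes n x y r :: nat
  assumes "x \<le> r" "r < y" "y \<le> (n - 1) * x" "2 \<le> n"
  shows "2 + (r - x) div x < n"
proof -
  have "(n - 1) * x = (n - 2) * x + x"
    using \<open>2 \<le> n\<close> by (cases n) (auto simp: algebra_simps Suc_diff_le)
  then have "r - x < (n - 2) * x" using assms by linarith
  then have "(r - x) div x < n - 2" by (rule less_mult_imp_div_less)
  then show ?thesis by linarith
qed

lemma card_edges_thin_tree:
  assumes n: "2 \<le> n" and x: "0 < x" and xy: "x \<le> y" "y \<le> (n - 1) * x"
  shows "card (edges n x y (thin_tree x :: _ \<Rightarrow> _ \<Rightarrow> _ \<Rightarrow> 'a::field)) = x + y - 1"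
proof -
  define E0 where "E0 = (\<lambda>r. (0::nat, r, r)) ` {..<x}"
  \<comment> \<open>The range ends at \<open>x - 1\<close> because the entry in row r stands in
    column \<open>Suc r\<close>, which must be below x.\<close>
  define E1 where "E1 = (\<lambda>r. (1::nat, r, Suc r)) ` {..<x - 1}"
  define E2 where "E2 = (\<lambda>r. (2 + (r - x) div x, r, (r - x) mod x)) ` {x..<y}"
  have "edges n x y (thin_tree x :: _ \<Rightarrow> _ \<Rightarrow> _ \<Rightarrow> 'a) = E0 \<union> E1 \<union> E2"
    using n x xy pendant_colour_less[OF _ _ xy(2) n]
    by (auto simp: edges_def thin_tree_def E0_def E1_def E2_def image_iff split: if_splits)
  moreover have "card (E0 \<union> E1 \<union> E2) = x + (x - 1) + (y - x)"
  proof -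
    have "card E0 = x" "card E1 = x - 1" "card E2 = y - x"
      unfolding E0_def E1_def E2_def by (subst card_image; auto simp: inj_on_def)+
    moreover have "E0 \<inter> E1 = {}" "(E0 \<union> E1) \<inter> E2 = {}" "finite E0" "finite E1" "finite E2"
      by (auto simp: E0_def E1_def E2_def)
    ultimately show ?thesis by (simp add: card_Un_disjoint)
  qed
  ultimately show ?thesis using x xy by simp
qed

section \<open>Idempotent endomorphisms of the thin tree\<close>

lemma mm_unit_col:
  "finite K \<Longrightarrow> g \<in> K \<Longrightarrow> (\<And>t. t \<in> K \<Longrightarrow> A t c = of_bool (t = g)) \<Longrightarrow> mm K Q A s c = Q s g"
  unfolding mm_def by (subst sum.remove[of _ g]) (auto intro!: sum.neutral)

lemma mm_unit_row:
  "finite K \<Longrightarrow> g \<in> K \<Longrightarrow> (\<And>t. t \<in> K \<Longrightarrow> A s t = of_bool (t = g)) \<Longrightarrow> mm K A P s c = P g c"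
  unfolding mm_def by (subst sum.remove[of _ g]) (auto intro!: sum.neutral)

text \<open>The first hypothesis says that P is upper triangular Toeplitz, a polynomial in the
  nilpotent Jordan block. With zero diagonal it is nilpotent, and a nilpotent idempotent vanishes;
  here this is an induction on columns.\<close>

lemma shift_commuting_idem_zero:
  fixes P :: "nat \<Rightarrow> nat \<Rightarrow> 'a::field"
  assumes c: "\<And>r c. Suc r < x \<Longrightarrow> c < x \<Longrightarrow> P (Suc r) c = (if c = 0 then 0 else P r (c - 1))"
    and i: "idem_m x P" and z: "P 0 0 = 0"
  shows "meq {..<x} {..<x} P zero_m"
proof -
  have "\<forall>r<x. P r c = 0" if "c < x" for c
    using that
  proof (induction c)
    case 0
    then show ?case using z c by (metis not0_implies_Suc)
  next
    case (Suc c')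
    have s: "P (Suc r) (Suc c') = 0" if "Suc r < x" for r
      using c[OF that Suc.prems] Suc that by simp
    \<comment> \<open>By \<open>s\<close> only the top entry of the column is in doubt. Idempotency
      expands it into products whose k = 0 term contains \<open>P 0 0\<close> and whose other terms
      contain entries already known to vanish.\<close>
    have "P 0 (Suc c') = (\<Sum>k<x. P 0 k * P k (Suc c'))"
      using i Suc.prems by (auto simp: idem_m_def meq_def mm_def)
    also have "\<dots> = 0"
    proof (intro sum.neutral ballI)
      fix k assume "k \<in> {..<x}"
      then show "P 0 k * P k (Suc c') = 0"
        using z s by (cases k) auto
    qed
    finally show ?case using s by (metis not0_implies_Suc)
  qed
  then show ?thesis by (simp add: meq_def zero_m_def)
qed

text \<open>Below the diagonal column 0 vanishes, so the diagonal entry is an idempotent of the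
  field, 0 or 1. The second case is the first one applied to 1 - P.\<close>

lemma shift_commuting_idem:
  fixes P :: "nat \<Rightarrow> nat \<Rightarrow> 'a::field"
  assumes x: "0 < x"
    and c: "\<And>r c. Suc r < x \<Longrightarrow> c < x \<Longrightarrow> P (Suc r) c = (if c = 0 then 0 else P r (c - 1))"
    and i: "idem_m x P"
  shows "meq {..<x} {..<x} P zero_m \<or> meq {..<x} {..<x} P one_m"
proof -
  have "P 0 0 = (\<Sum>k<x. P 0 k * P k 0)"
    using i x by (auto simp: idem_m_def meq_def mm_def)
  also have "\<dots> = P 0 0 * P 0 0"
  proof (subst sum.remove[of _ 0])
    have "(\<Sum>k\<in>{..<x} - {0}. P 0 k * P k 0) = 0"
    proof (intro sum.neutral ballI)
      fix k assume "k \<in> {..<x} - {0}"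
      then show "P 0 k * P k 0 = 0" using c[of "k - 1" 0] x by (cases k) auto
    qed
    then show "P 0 0 * P 0 0 + (\<Sum>k\<in>{..<x} - {0}. P 0 k * P k 0) = P 0 0 * P 0 0" by simp
  qed (use x in auto)
  finally consider "P 0 0 = 0" | "P 0 0 = 1" by auto
  then show ?thesis
  proof cases
    case 1
    with shift_commuting_idem_zero[of x P] c i show ?thesis by blast
  next
    case 2
    define D where "D = (\<lambda>r c. one_m r c - P r c)"
    have "mm {..<x} D D = (\<lambda>r c. mm {..<x} one_m one_m r c - mm {..<x} one_m P r c
        - mm {..<x} P one_m r c + mm {..<x} P P r c)"
      by (auto simp: D_def mm_def fun_eq_iff sum.distrib sum_subtractf algebra_simps)
    then have "idem_m x D"
      using i mm_one_left[of "{..<x}" "{..<x}" one_m] mm_one_left[of "{..<x}" "{..<x}" P]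
        mm_one_right[of "{..<x}" "{..<x}" P]
      by (simp add: idem_m_def meq_def D_def)
    moreover have "D (Suc r) c = (if c = 0 then 0 else D r (c - 1))" if "Suc r < x" "c < x" for r c
      using c[OF that] by (auto simp: D_def one_m_def)
    moreover have "D 0 0 = 0" by (simp add: D_def one_m_def 2)
    ultimately have "meq {..<x} {..<x} D zero_m" by (intro shift_commuting_idem_zero)
    then show ?thesis by (auto simp: D_def meq_def zero_m_def)
  qed
qed

text \<open>Colour 0 identifies the leading x by x block of Q with P, colour 1 makes P commute with
  the Jordan block, and Q is determined by P because every sink is hit.\<close>

lemma idem_trivial_thin_tree:
  assumes n: "2 \<le> n" and x: "0 < x" and xy: "x \<le> y" "y \<le> (n - 1) * x"
  shows "idem_trivial n x y (thin_tree x :: _ \<Rightarrow> _ \<Rightarrow> _ \<Rightarrow> 'a::field)"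
  unfolding idem_trivial_def
proof (intro allI impI)
  fix P Q :: "nat \<Rightarrow> nat \<Rightarrow> 'a"
  let ?A = "thin_tree x :: _ \<Rightarrow> _ \<Rightarrow> _ \<Rightarrow> 'a"
  assume h: "khom n x y ?A ?A P Q" and P: "idem_m x P" and "idem_m y Q"
  have h: "mm {..<y} Q (?A i) s c = mm {..<x} (?A i) P s c" if "i < n" "s < y" "c < x" for i s c
    using h that by (simp add: khom_def meq_def)
  have Q0: "Q s c = P s c" if "s < x" "c < x" for s c
  proof -
    have "mm {..<y} Q (?A 0) s c = Q s c"
      using that xy by (intro mm_unit_col) (auto simp: thin_tree_def)
    moreover have "mm {..<x} (?A 0) P s c = P s c"
      using that by (intro mm_unit_row) (auto simp: thin_tree_def)
    ultimately show ?thesis using h[of 0 s c] that n xy by simp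
  qed
  have shift: "P (Suc s) c = (if c = 0 then 0 else P s (c - 1))" if "Suc s < x" "c < x" for s c
  proof -
    have "mm {..<x} (?A 1) P s c = P (Suc s) c"
      using that by (intro mm_unit_row) (auto simp: thin_tree_def)
    moreover have "mm {..<y} Q (?A 1) s c = (if c = 0 then 0 else Q s (c - 1))"
    proof (cases c)
      case 0
      then show ?thesis by (auto simp: mm_def thin_tree_def intro!: sum.neutral)
    next
      case (Suc c')
      then have "mm {..<y} Q (?A 1) s c = Q s c'"
        using that xy by (intro mm_unit_col) (auto simp: thin_tree_def)
      with Suc show ?thesis by simp
    qed
    ultimately show ?thesis using h[of 1 s c] Q0[of s "c - 1"] that n xy by auto
  qed
  \<comment> \<open>Every sink r is the image of a source basis vector under a single colour. For
    pendant sinks quotient and remainder of r - x by x give colour and source, and together recover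
    r.\<close>
  have col: "\<exists>i<n. \<exists>c<x. \<forall>t<y. ?A i t c = of_bool (t = r)" if "r < y" for r
  proof (cases "r < x")
    case True
    then have "\<forall>t<y. ?A 0 t r = of_bool (t = r)" by (auto simp: thin_tree_def)
    moreover have "0 < n" using n by simp
    ultimately show ?thesis using True by blast
  next
    case False
    have "t = r" if "(r - x) div x = (t - x) div x" "(r - x) mod x = (t - x) mod x" "\<not> t < x" for t
    proof -
      have "r - x = t - x"
        using that(1,2) by (metis div_mult_mod_eq)
      then show ?thesis using False that(3) by linarith
    qed
    then have "\<forall>t<y. ?A (2 + (r - x) div x) t ((r - x) mod x) = of_bool (t = r)"
      using False by (auto simp: thin_tree_def)
    moreover have "2 + (r - x) div x < n" "(r - x) mod x < x"
      using pendant_colour_less[OF _ that xy(2) n] False x by auto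
    ultimately show ?thesis by blast
  qed
  have Qr: "\<exists>i<n. \<exists>c<x. \<forall>s<y. Q s r = mm {..<x} (?A i) P s c \<and> ?A i s c = of_bool (s = r)" if r: "r < y" for r
  proof -
    obtain i c where ic: "i < n" "c < x" "\<forall>t<y. ?A i t c = of_bool (t = r)" using col[OF r] by blast
    have "Q s r = mm {..<x} (?A i) P s c" if "s < y" for s
      using mm_unit_col[of "{..<y}" r "?A i" c Q s] ic r h[of i s c] that by simp
    then show ?thesis using ic by blast
  qed
  have "meq {..<x} {..<x} P zero_m \<or> meq {..<x} {..<x} P one_m"
    using shift_commuting_idem[OF x shift P] .
  then show "meq {..<x} {..<x} P zero_m \<and> meq {..<y} {..<y} Q zero_m \<or>
     meq {..<x} {..<x} P one_m \<and> meq {..<y} {..<y} Q one_m"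
  proof
    assume p: "meq {..<x} {..<x} P zero_m"
    have *: "mm {..<x} (?A i) P s c = 0" if "c < x" for i s c
      using p that by (simp add: mm_def meq_def zero_m_def)
    have "Q s r = 0" if "s < y" "r < y" for s r
      using Qr[OF that(2)] * that(1) by metis
    then have "meq {..<y} {..<y} Q zero_m"
      by (simp add: meq_def zero_m_def)
    with p show ?thesis by simp
  next
    assume p: "meq {..<x} {..<x} P one_m"
    have *: "mm {..<x} (?A i) P s c = ?A i s c" if "c < x" "s < y" for i s c
      using meq_trans[OF mm_cong[OF meq_refl p] mm_one_right, of "{..<y}" "?A i"] that by (simp add: meq_def)
    have "Q s r = of_bool (s = r)" if "s < y" "r < y" for s r
      using Qr[OF that(2)] * that(1) by metis
    then have "meq {..<y} {..<y} Q one_m"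
      by (simp add: meq_def one_m_def)
    with p show ?thesis by simp
  qed
qed

section \<open>Permuting the arrows\<close>

(* A vector v is a matrix with a single column, indexed by unit. *)
definition inj_colour :: "nat \<Rightarrow> nat \<Rightarrow> (nat \<Rightarrow> nat \<Rightarrow> nat \<Rightarrow> 'a::field) \<Rightarrow> nat \<Rightarrow> bool" where
  "inj_colour x y A i \<longleftrightarrow> (\<forall>v :: nat \<Rightarrow> unit \<Rightarrow> 'a.
     meq {..<y} UNIV (mm {..<x} (A i) v) zero_m \<longrightarrow> meq {..<x} UNIV v zero_m)"

text \<open>An isomorphism maps the kernel of each colour into the kernel of the same colour, so the
  set of injective colours is an invariant.\<close>

lemma inj_colour_kiso:
  assumes k: "kiso n x y A B" and i: "i < n" and B: "inj_colour x y B i"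
  shows "inj_colour x y A i"
  unfolding inj_colour_def
proof (intro allI impI)
  fix v :: "nat \<Rightarrow> unit \<Rightarrow> 'a"
  assume v: "meq {..<y} UNIV (mm {..<x} (A i) v) zero_m"
  obtain P Q P' where h: "khom n x y A B P Q" and inv: "inverse_m x P P'"
    using k unfolding kiso_def by blast
  have "meq {..<y} UNIV (mm {..<x} (B i) (mm {..<x} P v)) (mm {..<x} (mm {..<y} Q (A i)) v)"
    unfolding mm_assoc[symmetric] using h i by (intro mm_cong[OF meq_sym meq_refl]) (simp add: khom_def)
  also have "meq {..<y} UNIV \<dots> (mm {..<y} Q zero_m)"
    unfolding mm_assoc by (intro mm_cong meq_refl v)
  finally have Pv: "meq {..<x} UNIV (mm {..<x} P v) zero_m"
    using B unfolding inj_colour_def by simp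
  have "meq {..<x} UNIV v (mm {..<x} one_m v)"
    by (intro meq_sym[OF mm_one_left]) simp
  also have "meq {..<x} UNIV \<dots> (mm {..<x} (mm {..<x} P' P) v)"
    using inv by (intro mm_cong[OF meq_sym meq_refl]) (simp add: inverse_m_def)
  also have "meq {..<x} UNIV \<dots> (mm {..<x} P' zero_m)"
    unfolding mm_assoc by (intro mm_cong meq_refl Pv)
  finally show "meq {..<x} UNIV v zero_m" by simp
qed

lemma inj_colour_thin_tree_0: "x \<le> y \<Longrightarrow> inj_colour x y (thin_tree x) 0"
  unfolding inj_colour_def meq_def
proof (intro allI impI ballI)
  fix v :: "nat \<Rightarrow> unit \<Rightarrow> 'a" and s u
  assume xy: "x \<le> y" and v: "\<forall>s\<in>{..<y}. \<forall>u\<in>UNIV. mm {..<x} (thin_tree x 0) v s u = zero_m s u" and s: "s \<in> {..<x}"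
  have "mm {..<x} (thin_tree x 0) v s u = v s u"
    using s by (intro mm_unit_row) (auto simp: thin_tree_def)
  then show "v s u = zero_m s u" using v s xy by (auto simp: zero_m_def)
qed

lemma not_inj_colour_thin_tree_1:
  assumes "0 < x"
  shows "\<not> inj_colour x y (thin_tree x :: _ \<Rightarrow> _ \<Rightarrow> _ \<Rightarrow> 'a::field) 1"
proof -
  \<comment> \<open>The first source has no arrow of colour 1, as that colour leads from
    \<open>Suc r\<close> to r; its basis vector lies in the kernel.\<close>
  define v :: "nat \<Rightarrow> unit \<Rightarrow> 'a" where "v = (\<lambda>b u. of_bool (b = 0))"
  have "mm {..<x} (thin_tree x 1) v = zero_m"
    by (auto simp: fun_eq_iff mm_def zero_m_def v_def thin_tree_def intro!: sum.neutral)
  moreover have "\<not> meq {..<x} UNIV v zero_m"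
    using assms by (auto simp: meq_def zero_m_def v_def)
  ultimately show ?thesis by (metis inj_colour_def meq_refl)
qed

text \<open>For j > 0 exchange j with 0 or 1, whichever has the opposite value under S. This flips S
  exactly at j and at that partner, and the resulting pairs are distinct; j = 0 flips
  nothing.\<close>

lemma separating_involutions:
  fixes S :: "nat \<Rightarrow> bool"
  assumes S: "S 0" "\<not> S 1" and n: "2 \<le> n"
  shows "\<exists>t. (\<forall>j<n. \<forall>i<n. t j i < n \<and> t j (t j i) = i) \<and>
             (\<forall>j<n. \<forall>l<n. j \<noteq> l \<longrightarrow> (\<exists>i<n. S (t j i) \<noteq> S (t l i)))"
proof -
  define sw :: "nat \<Rightarrow> nat \<Rightarrow> nat \<Rightarrow> nat" where "sw a b i = (if i = a then b else if i = b then a else i)" for a b i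
  define t where "t j = (if j = 0 then id else if S j then sw 1 j else sw 0 j)" for j
  have "\<exists>i<n. S (t j i) \<noteq> S (t l i)" if "j < l" "l < n" for j l
  proof -
    \<comment> \<open>For j < l the position l tells the two apart unless l = 1, when j = 0 and
      position 0 does.\<close>
    have "S (t j 0) \<noteq> S (t l 0) \<or> S (t j l) \<noteq> S (t l l)"
      using that S by (cases "j = 1"; cases "l = 1"; auto simp: t_def sw_def)
    then show ?thesis using that n by (metis less_trans not_less_zero neq0_conv)
  qed
  then have "\<forall>j<n. \<forall>l<n. j \<noteq> l \<longrightarrow> (\<exists>i<n. S (t j i) \<noteq> S (t l i))"
    by (metis linorder_neqE_nat)
  moreover have "\<forall>j<n. \<forall>i<n. t j i < n \<and> t j (t j i) = i"
    using n by (auto simp: t_def sw_def)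
  ultimately show ?thesis by blast
qed

lemma permute_colours:
  assumes t: "\<And>i. i < n \<Longrightarrow> t i < n \<and> t (t i) = i"
  shows "idem_trivial n x y A \<Longrightarrow> idem_trivial n x y (\<lambda>i. A (t i))"
    and "card (edges n x y (\<lambda>i. A (t i))) = card (edges n x y A)"
proof -
  have "khom n x y A A P Q" if "khom n x y (\<lambda>i. A (t i)) (\<lambda>i. A (t i)) P Q" for P Q
    using that t unfolding khom_def by metis
  then show "idem_trivial n x y A \<Longrightarrow> idem_trivial n x y (\<lambda>i. A (t i))"
    unfolding idem_trivial_def by blast
  have "edges n x y (\<lambda>i. A (t i)) = (\<lambda>(i, r, c). (t i, r, c)) ` edges n x y A"
  proof (intro equalityI subsetI)
    fix e assume "e \<in> edges n x y (\<lambda>i. A (t i))"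
    then obtain i r c where "e = (i, r, c)" "i < n" "r < y" "c < x" "A (t i) r c \<noteq> 0"
      by (auto simp: edges_def)
    then have "e = (t (t i), r, c)" "(t i, r, c) \<in> edges n x y A"
      using t by (simp_all add: edges_def)
    then show "e \<in> (\<lambda>(i, r, c). (t i, r, c)) ` edges n x y A" by force
  qed (use t in \<open>auto simp: edges_def\<close>)
  moreover have "inj_on (\<lambda>(i, r, c). (t i, r, c)) (edges n x y A)"
  proof -
    have "i = i'" if "i < n" "i' < n" "t i = t i'" for i i'
      using t that by metis
    then show ?thesis by (auto simp: inj_on_def edges_def)
  qed
  ultimately show "card (edges n x y (\<lambda>i. A (t i))) = card (edges n x y A)"
    by (simp add: card_image)
qed

section \<open>Families of n tree modules\<close>

definition tree_family :: "nat \<Rightarrow> nat \<Rightarrow> nat \<Rightarrow> (nat \<Rightarrow> nat \<Rightarrow> nat \<Rightarrow> nat \<Rightarrow> 'a::field) \<Rightarrow> bool" where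
  "tree_family n x y F \<longleftrightarrow>
     (\<forall>j<n. idem_trivial n x y (F j) \<and> card (edges n x y (F j)) = x + y - 1) \<and>
     (\<forall>j<n. \<forall>l<n. j \<noteq> l \<longrightarrow> \<not> kiso n x y (F j) (F l))"

lemma thin_tree_family:
  assumes n: "2 \<le> n" and x: "0 < x" and xy: "x \<le> y" "y \<le> (n - 1) * x"
  shows "\<exists>F :: nat \<Rightarrow> nat \<Rightarrow> nat \<Rightarrow> nat \<Rightarrow> 'a::field.
     tree_family n x y F \<and> (\<forall>j<n. \<exists>i<n. pivoted x y (F j) i)"
proof -
  let ?A = "thin_tree x :: nat \<Rightarrow> nat \<Rightarrow> nat \<Rightarrow> 'a"
  obtain t where t: "\<And>j i. j < n \<Longrightarrow> i < n \<Longrightarrow> t j i < n \<and> t j (t j i) = i"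
    and sep: "\<And>j l. j < n \<Longrightarrow> l < n \<Longrightarrow> j \<noteq> l \<Longrightarrow> \<exists>i<n. inj_colour x y ?A (t j i) \<noteq> inj_colour x y ?A (t l i)"
    using separating_involutions[of "inj_colour x y ?A" n] n inj_colour_thin_tree_0[OF xy(1)] 
      not_inj_colour_thin_tree_1[OF x] by metis
  define F where "F j i = ?A (t j i)" for j i
  have "\<not> kiso n x y (F j) (F l)" if jl: "j < n" "l < n" "j \<noteq> l" for j l
  proof
    assume k: "kiso n x y (F j) (F l)"
    obtain i where i: "i < n" "inj_colour x y ?A (t j i) \<noteq> inj_colour x y ?A (t l i)"
      using sep[OF jl] by blast
    have "inj_colour x y (F j) i \<noteq> inj_colour x y (F l) i"
      using i by (simp add: inj_colour_def F_def)
    then show False using inj_colour_kiso[OF k i(1)] inj_colour_kiso[OF kiso_sym[OF k] i(1)] by blast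
  qed
  moreover have "idem_trivial n x y (F j)" "card (edges n x y (F j)) = x + y - 1" if "j < n" for j
    unfolding F_def using permute_colours[of n "t j" x y ?A] t[OF that] 
      idem_trivial_thin_tree[OF assms] card_edges_thin_tree[OF assms] by auto
  moreover have "\<exists>i<n. pivoted x y (F j) i" if "j < n" for j
  proof -
    \<comment> \<open>As \<open>t j\<close> is an involution, the identity block of colour 0 now
      sits in colour \<open>t j 0\<close>.\<close>
    have "F j (t j 0) = ?A 0" "t j 0 < n" using t[OF that, of 0] n by (auto simp: F_def)
    moreover have "?A 0 c c' = of_bool (c = c')" if "c < x" for c c'
      using that by (simp add: thin_tree_def)
    ultimately show ?thesis
      using xy by (intro exI[of _ "t j 0"]) (auto simp: pivoted_def intro!: exI[of _ id])
  qed
  ultimately show ?thesis unfolding tree_family_def by blast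
qed

text \<open>Induction on the larger coordinate: reflection replaces (x, y) by (z, x) with x < y. The
  pivot clause is part of the induction because each reflection uses up one pivot colour and returns
  another.\<close>

lemma tree_family_exists:
  assumes n: "2 \<le> n" and "0 < x" "x \<le> y" "x * x + y * y \<le> n * x * y"
  shows "\<exists>F :: nat \<Rightarrow> nat \<Rightarrow> nat \<Rightarrow> nat \<Rightarrow> 'a::field.
     tree_family n x y F \<and> (\<forall>j<n. \<exists>i<n. pivoted x y (F j) i)"
  using assms(2-)
proof (induction y arbitrary: x rule: less_induct)
  case (less y)
  show ?case
  proof (cases "y \<le> (n - 1) * x")
    case True
    then show ?thesis using thin_tree_family n less.prems by blast
  next
    case False
    \<comment> \<open>Positivity of x makes \<open>y * y < n * x * y\<close> strict, hence y < n x
      and z > 0.\<close>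
    have "0 < x * x" using less.prems(1) by simp
    then have "y * y < n * x * y" using less.prems(3) by linarith
    then have ynx: "y < n * x" by simp
    define z where "z = n * x - y"
    have z: "0 < z" "y + z = n * x" using ynx by (auto simp: z_def)
    have "n * x = (n - 1) * x + x" using n by (cases n) auto
    then have zx: "z \<le> x" using False z by linarith
    have "x \<le> (n - 1) * x" using n by (cases n) auto
    then have xy: "x < y" using False by linarith
    \<comment> \<open>Reflection preserves the quadratic form: with n x = y + z the condition
      reduces to x x \<le> z y, which is symmetric between the two dimension vectors.\<close>
    have "x * x + y * y \<le> (y + z) * y" using less.prems(3) z by simp
    then have "z * z + x * x \<le> z * (y + z)" by (simp add: algebra_simps)
    also have "\<dots> = n * z * x" using z by (simp add: mult_ac)
    finally have "z * z + x * x \<le> n * z * x" .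
    then obtain F :: "nat \<Rightarrow> nat \<Rightarrow> nat \<Rightarrow> nat \<Rightarrow> 'a" where F: "tree_family n z x F"
        and pv: "\<And>j. j < n \<Longrightarrow> \<exists>i<n. pivoted z x (F j) i"
      using less.IH[OF xy z(1) zx] by blast
    have "\<exists>M L S. split_exact n z x y (F j) M L S \<and> card (edges n x y M) = x + y - 1 \<and> (\<exists>i<n. pivoted x y M i)"
      if j: "j < n" for j
    proof -
      obtain i0 where i0: "i0 < n" "pivoted z x (F j) i0" using pv[OF j] by blast
      \<comment> \<open>Any colour other than i0 works as the next pivot colour; one exists since n
        \<ge> 2.\<close>
      define i1 where "i1 = (if i0 = 0 then 1 else 0 :: nat)"
      have i1: "i1 < n" "i1 \<noteq> i0" using n by (auto simp: i1_def)
      have "card (edges n z x (F j)) = z + x - 1" using F j by (simp add: tree_family_def)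
      then show ?thesis
        using reflect_exists[OF i0(2,1) i1 z(2) less.prems(1)] i1 by blast
    qed
    then obtain M L S where M: "\<And>j. j < n \<Longrightarrow> split_exact n z x y (F j) (M j) (L j) (S j)"
      "\<And>j. j < n \<Longrightarrow> card (edges n x y (M j)) = x + y - 1" "\<And>j. j < n \<Longrightarrow> \<exists>i<n. pivoted x y (M j) i"
      by metis
    have "tree_family n x y M"
      using F M(2) reflect_iso[OF M(1) M(1)] reflect_idem_trivial[OF M(1)]
      unfolding tree_family_def by metis
    with M(3) show ?thesis by blast
  qed
qed

section \<open>Transposition\<close>

definition flip_m :: "('i \<Rightarrow> 'j \<Rightarrow> 'a) \<Rightarrow> 'j \<Rightarrow> 'i \<Rightarrow> 'a" where
  "flip_m f = (\<lambda>i j. f j i)"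

definition transp :: "(nat \<Rightarrow> nat \<Rightarrow> nat \<Rightarrow> 'a) \<Rightarrow> nat \<Rightarrow> nat \<Rightarrow> nat \<Rightarrow> 'a" where
  "transp A = (\<lambda>i. flip_m (A i))"

lemma mm_flip: "mm K (flip_m f) (flip_m g) = flip_m (mm K g f)"
  by (simp add: mm_def flip_m_def mult.commute)

lemma flip_flip [simp]: "flip_m (flip_m f) = f"
  by (simp add: flip_m_def)

lemma meq_flip: "meq I J (flip_m f) (flip_m g) \<longleftrightarrow> meq J I f g"
  by (auto simp: meq_def flip_m_def)

lemma flip_one: "flip_m one_m = one_m"
  by (auto simp: one_m_def flip_m_def fun_eq_iff)

lemma flip_zero: "flip_m zero_m = zero_m"
  by (simp add: zero_m_def flip_m_def)

text \<open>Transposing is a duality: it swaps source and sink spaces and reverses the direction of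
  homomorphisms.\<close>

lemma khom_transp:
  assumes "khom n x y (transp A) (transp B) P Q"
  shows "khom n y x B A (flip_m Q) (flip_m P)"
  unfolding khom_def
proof (intro allI impI)
  fix i assume "i < n"
  then have "meq {..<y} {..<x} (mm {..<y} Q (flip_m (A i))) (mm {..<x} (flip_m (B i)) P)"
    using assms by (simp add: khom_def transp_def)
  then have "meq {..<x} {..<y} (mm {..<y} (A i) (flip_m Q)) (mm {..<x} (flip_m P) (B i))"
    using mm_flip[of "{..<y}" "A i" "flip_m Q"] mm_flip[of "{..<x}" "flip_m P" "B i"] meq_flip
    by (metis flip_flip mm_flip)
  then show "meq {..<x} {..<y} (mm {..<x} (flip_m P) (B i)) (mm {..<y} (A i) (flip_m Q))"
    by (rule meq_sym)
qed

lemma inverse_m_flip: "inverse_m x P P' \<Longrightarrow> inverse_m x (flip_m P) (flip_m P')"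
  unfolding inverse_m_def mm_flip by (metis flip_one meq_flip)

lemma idem_m_flip: "idem_m x P \<Longrightarrow> idem_m x (flip_m P)"
  unfolding idem_m_def mm_flip by (simp add: meq_flip)

lemma kiso_transp:
  assumes "kiso n x y (transp A) (transp B)"
  shows "kiso n y x A B"
proof -
  obtain P Q P' Q' where k: "khom n x y (transp A) (transp B) P Q" "khom n x y (transp B) (transp A) P' Q'"
    "inverse_m x P P'" "inverse_m y Q Q'"
    using assms unfolding kiso_def by blast
  have "kiso n y x B A"
    unfolding kiso_def
    using khom_transp[OF k(1)] khom_transp[OF k(2)] inverse_m_flip[OF k(3)] inverse_m_flip[OF k(4)] by blast
  then show ?thesis by (rule kiso_sym)
qed

lemma idem_trivial_transp:
  assumes "idem_trivial n y x A"
  shows "idem_trivial n x y (transp A)"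
  unfolding idem_trivial_def
proof (intro allI impI)
  fix P Q assume "khom n x y (transp A) (transp A) P Q" "idem_m x P" "idem_m y Q"
  then have "meq {..<y} {..<y} (flip_m Q) zero_m \<and> meq {..<x} {..<x} (flip_m P) zero_m \<or>
     meq {..<y} {..<y} (flip_m Q) one_m \<and> meq {..<x} {..<x} (flip_m P) one_m"
    using assms khom_transp idem_m_flip unfolding idem_trivial_def by blast
  then show "meq {..<x} {..<x} P zero_m \<and> meq {..<y} {..<y} Q zero_m \<or>
     meq {..<x} {..<x} P one_m \<and> meq {..<y} {..<y} Q one_m"
    by (metis meq_flip flip_zero flip_one)
qed

lemma card_edges_transp: "card (edges n x y (transp A)) = card (edges n y x A)"
  by (rule bij_betw_same_card[of "\<lambda>(i, r, c). (i, c, r)"], rule bij_betwI[where g = "\<lambda>(i, r, c). (i, c, r)"])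
    (auto simp: edges_def transp_def flip_m_def)

lemma tree_family_transp: "tree_family n y x F \<Longrightarrow> tree_family n x y (\<lambda>j. transp (F j))"
  unfolding tree_family_def
  using kiso_transp idem_trivial_transp card_edges_transp by (metis add.commute)

section \<open>Translation to matrices\<close>

definition rep_mat :: "nat \<Rightarrow> nat \<Rightarrow> (nat \<Rightarrow> nat \<Rightarrow> nat \<Rightarrow> 'a) \<Rightarrow> nat \<Rightarrow> 'a mat" where
  "rep_mat x y A = (\<lambda>i. mat y x (\<lambda>(r, c). A i r c))"

definition fun_mat :: "'a mat \<Rightarrow> nat \<Rightarrow> nat \<Rightarrow> 'a" where
  "fun_mat P = (\<lambda>i j. P $$ (i, j))"

lemma rep_mat_carrier [simp]: "rep_mat x y A i \<in> carrier_mat y x"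
  by (simp add: rep_mat_def)

lemma mm_fun_mat:
  assumes "P \<in> carrier_mat a b" "Q \<in> carrier_mat b c"
  shows "meq {..<a} {..<c} (mm {..<b} (fun_mat P) (fun_mat Q)) (fun_mat (P * Q))"
  using assms by (auto simp: meq_def mm_def fun_mat_def scalar_prod_def atLeast0LessThan)

lemma fun_mat_rep: "meq {..<y} {..<x} (fun_mat (rep_mat x y A i)) (A i)"
  by (simp add: meq_def fun_mat_def rep_mat_def)

lemma khom_rep_mat:
  assumes P: "P \<in> carrier_mat x x" and Q: "Q \<in> carrier_mat y y"
    and h: "\<forall>i<n. Q * rep_mat x y A i = rep_mat x y B i * P"
  shows "khom n x y A B (fun_mat P) (fun_mat Q)"
  unfolding khom_def
proof (intro allI impI)
  fix i assume i: "i < n"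
  have "meq {..<y} {..<x} (mm {..<y} (fun_mat Q) (A i)) (mm {..<y} (fun_mat Q) (fun_mat (rep_mat x y A i)))"
    by (intro mm_cong meq_refl meq_sym[OF fun_mat_rep])
  also have "meq {..<y} {..<x} \<dots> (fun_mat (Q * rep_mat x y A i))"
    by (rule mm_fun_mat[OF Q]) simp
  also have "Q * rep_mat x y A i = rep_mat x y B i * P" using h i by simp
  also have "meq {..<y} {..<x} (fun_mat (rep_mat x y B i * P)) (mm {..<x} (fun_mat (rep_mat x y B i)) (fun_mat P))"
    by (rule meq_sym[OF mm_fun_mat[OF _ P]]) simp
  also have "meq {..<y} {..<x} \<dots> (mm {..<x} (B i) (fun_mat P))"
    by (intro mm_cong meq_refl fun_mat_rep)
  finally show "meq {..<y} {..<x} (mm {..<y} (fun_mat Q) (A i)) (mm {..<x} (B i) (fun_mat P))" .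
qed

lemma fun_mat_one: "meq {..<x} {..<x} (fun_mat (1\<^sub>m x)) one_m"
  by (simp add: meq_def fun_mat_def one_m_def)

lemma invertible_matE:
  assumes "invertible_mat P" "P \<in> carrier_mat x x"
  obtains P' where "P' \<in> carrier_mat x x" "P * P' = 1\<^sub>m x" "P' * P = 1\<^sub>m x"
proof -
  obtain P' where P': "P * P' = 1\<^sub>m x" "P' * P = 1\<^sub>m (dim_row P')"
    using assms by (auto simp: invertible_mat_def inverts_mat_def)
  \<comment> \<open>The shape of the inverse is recovered by comparing column counts in the two
    identities.\<close>
  have "dim_col P' = x" "dim_row P' = x"
    using arg_cong[OF P'(1), of dim_col] arg_cong[OF P'(2), of dim_col] assms by simp_all
  then show thesis using that[of P'] P' by auto
qed

lemma inverse_fun_mat: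
  assumes "P \<in> carrier_mat x x" "P' \<in> carrier_mat x x" "P * P' = 1\<^sub>m x" "P' * P = 1\<^sub>m x"
  shows "inverse_m x (fun_mat P) (fun_mat P')"
  unfolding inverse_m_def
  using meq_trans[OF mm_fun_mat[OF assms(1,2), unfolded assms] fun_mat_one]
    meq_trans[OF mm_fun_mat[OF assms(2,1), unfolded assms] fun_mat_one] by blast

lemma inverse_intertwine:
  fixes A B :: "'a::field mat"
  assumes A: "A \<in> carrier_mat y x" and B: "B \<in> carrier_mat y x"
    and P: "P \<in> carrier_mat x x" and P': "P' \<in> carrier_mat x x" "P * P' = 1\<^sub>m x"
    and Q: "Q \<in> carrier_mat y y" and Q': "Q' \<in> carrier_mat y y" "Q' * Q = 1\<^sub>m y"
    and h: "Q * A = B * P"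
  shows "Q' * B = A * P'"
proof -
  have "Q' * B = Q' * (B * (P * P'))" using B P' by simp
  also have "\<dots> = Q' * ((Q * A) * P')" using h B P P' by simp
  also have "\<dots> = (Q' * Q) * (A * P')"
    using A P' Q Q'(1) by (simp add: assoc_mult_mat[of _ y y _ y _ x] assoc_mult_mat[of _ y y _ x _ x])
  finally show ?thesis using Q' A P' by simp
qed

text \<open>Pulls the endomorphism (E, G) of D back to A along the isomorphism (P, Q).\<close>

lemma conj_intertwine:
  fixes A D :: "'a::field mat"
  assumes A: "A \<in> carrier_mat y x" and D: "D \<in> carrier_mat y x"
    and P: "P \<in> carrier_mat x x" and P': "P' \<in> carrier_mat x x" "P * P' = 1\<^sub>m x"
    and Q: "Q \<in> carrier_mat y y" and Q': "Q' \<in> carrier_mat y y" "Q' * Q = 1\<^sub>m y"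
    and E: "E \<in> carrier_mat x x" and G: "G \<in> carrier_mat y y"
    and h: "Q * A = D * P" and GD: "G * D = D * E"
  shows "Q' * G * Q * A = A * (P' * E * P)"
proof -
  have "Q' * G * Q * A = Q' * (G * (D * P))"
    using A Q Q'(1) G h by (simp add: assoc_mult_mat[of _ y y _ y _ x] assoc_mult_mat[of _ y y _ y _ y])
  also have "\<dots> = Q' * ((G * D) * P)" using G D P by simp
  also have "\<dots> = (Q' * D) * (E * P)"
    unfolding GD using Q'(1) D E P by (simp add: assoc_mult_mat[of _ y x _ x _ x] assoc_mult_mat[of _ y y _ x _ x])
  also have "\<dots> = (A * P') * (E * P)" by (simp only: inverse_intertwine[OF assms(1-8) h])
  also have "\<dots> = A * (P' * E * P)"
    using A P'(1) E P by (simp add: assoc_mult_mat[of _ y x _ x _ x] assoc_mult_mat[of _ x x _ x _ x])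
  finally show ?thesis .
qed

lemma rep_iso_imp_kiso:
  fixes A B :: "nat \<Rightarrow> nat \<Rightarrow> nat \<Rightarrow> 'a::field"
  assumes "rep_iso n x y (rep_mat x y A) (rep_mat x y B)"
  shows "kiso n x y A B"
proof -
  obtain P Q where PQ: "P \<in> carrier_mat x x" "Q \<in> carrier_mat y y" "invertible_mat P" "invertible_mat Q"
    and h: "\<forall>i<n. Q * rep_mat x y A i = rep_mat x y B i * P"
    using assms unfolding rep_iso_def by blast
  obtain P' where P': "P' \<in> carrier_mat x x" "P * P' = 1\<^sub>m x" "P' * P = 1\<^sub>m x"
    using invertible_matE PQ by blast
  obtain Q' where Q': "Q' \<in> carrier_mat y y" "Q * Q' = 1\<^sub>m y" "Q' * Q = 1\<^sub>m y"
    using invertible_matE PQ by blast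
  have "Q' * rep_mat x y B i = rep_mat x y A i * P'" if "i < n" for i
    using that h by (intro inverse_intertwine[OF _ _ PQ(1) P'(1,2) PQ(2) Q'(1,3)]) auto
  then have "khom n x y B A (fun_mat P') (fun_mat Q')"
    using P' Q' by (intro khom_rep_mat) auto
  moreover have "khom n x y A B (fun_mat P) (fun_mat Q)"
    using PQ h by (intro khom_rep_mat) auto
  ultimately show ?thesis
    unfolding kiso_def using inverse_fun_mat PQ P' Q' by blast
qed

lemma rep_iso_refl:
  assumes "kronecker_rep n x y A"
  shows "rep_iso n x y A A"
proof -
  have "invertible_mat (1\<^sub>m m :: 'a mat)" for m
    unfolding invertible_mat_def inverts_mat_def by (auto intro!: exI[of _ "1\<^sub>m m"])
  then show ?thesis unfolding rep_iso_def
    using assms by (intro exI[of _ "1\<^sub>m x"] exI[of _ "1\<^sub>m y"]) (auto simp: kronecker_rep_def)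
qed

section \<open>Direct sums and idempotent endomorphisms\<close>

definition block_proj :: "nat \<Rightarrow> nat \<Rightarrow> 'a::field mat" where
  "block_proj a b = four_block_mat (1\<^sub>m a) (0\<^sub>m a b) (0\<^sub>m b a) (0\<^sub>m b b)"

lemma block_proj_carrier [simp]: "block_proj a b \<in> carrier_mat (a + b) (a + b)"
  by (simp add: block_proj_def)

lemma block_proj_idem: "block_proj a b * block_proj a b = (block_proj a b :: 'a::field mat)"
  unfolding block_proj_def
  by (subst mult_four_block_mat[of _ a a _ b _ b _ _ a _ b]) auto

lemma block_proj_zero:
  assumes e: "block_proj a b = (0\<^sub>m (a + b) (a + b) :: 'a::field mat)"
  shows "a = 0"
proof (rule ccontr)
  assume "a \<noteq> 0"
  then have "(block_proj a b :: 'a mat) $$ (0, 0) = 1" by (simp add: block_proj_def)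
  then show False using \<open>a \<noteq> 0\<close> unfolding e by simp
qed

lemma block_proj_one:
  assumes e: "block_proj a b = (1\<^sub>m (a + b) :: 'a::field mat)"
  shows "b = 0"
proof (rule ccontr)
  assume "b \<noteq> 0"
  then have "(block_proj a b :: 'a mat) $$ (a, a) = 0" by (simp add: block_proj_def)
  then show False using \<open>b \<noteq> 0\<close> unfolding e by simp
qed

text \<open>The projection onto the first summand is an endomorphism of a direct sum.\<close>

lemma block_proj_dsum:
  assumes "B i \<in> carrier_mat y1 x1" "C i \<in> carrier_mat y2 x2"
  shows "block_proj y1 y2 * rep_dsum x1 y1 x2 y2 B C i = rep_dsum x1 y1 x2 y2 B C i * block_proj x1 x2"
  unfolding block_proj_def rep_dsum_def using assms
  by (subst mult_four_block_mat[of _ y1 y1 _ y2 _ y2 _ _ x1 _ x2], auto)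
     (subst mult_four_block_mat[of _ y1 x1 _ x2 _ y2 _ _ x1 _ x2], auto)

lemma meq_fun_mat:
  assumes "P \<in> carrier_mat a b" "Q \<in> carrier_mat a b"
  shows "meq {..<a} {..<b} (fun_mat P) (fun_mat Q) \<longleftrightarrow> P = Q"
  using assms by (auto simp: meq_def fun_mat_def intro!: eq_matI)

lemma fun_mat_zero: "meq {..<a} {..<b} (fun_mat (0\<^sub>m a b)) zero_m"
  by (simp add: meq_def fun_mat_def zero_m_def)

lemma conj_proj:
  fixes P P' E :: "'a::field mat"
  assumes "P \<in> carrier_mat x x" "P' \<in> carrier_mat x x" "P * P' = 1\<^sub>m x" "P' * P = 1\<^sub>m x"
    and E: "E \<in> carrier_mat x x"
  shows "P * (P' * E * P) * P' = E" and "E * E = E \<Longrightarrow> P' * E * P * (P' * E * P) = P' * E * P"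
proof -
  have "P * (P' * E * P) * P' = (P * P') * E * (P * P')"
    using assms(1,2,5) by (simp add: assoc_mult_mat[of _ x x _ x _ x])
  then show "P * (P' * E * P) * P' = E" using assms by simp
  have "P' * E * P * (P' * E * P) = P' * (E * (P * P') * E) * P"
    using assms(1,2,5) by (simp add: assoc_mult_mat[of _ x x _ x _ x])
  then show "E * E = E \<Longrightarrow> P' * E * P * (P' * E * P) = P' * E * P" using assms by simp
qed

text \<open>A decomposition provides the projection onto its first summand, which is conjugated to
  an idempotent of A. If that is 0 the first summand has dimension vector zero, if it is 1 the
  second has.\<close>

lemma idem_trivial_imp_indecomposable:
  fixes A :: "nat \<Rightarrow> nat \<Rightarrow> nat \<Rightarrow> 'a::field"
  assumes t: "idem_trivial n x y A" and pos: "0 < x + y"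
  shows "rep_indecomposable n x y (rep_mat x y A)"
proof -
  have False
    if d: "x1 + x2 = x" "y1 + y2 = y" "0 < x1 + y1" "0 < x2 + y2"
      and BC: "kronecker_rep n x1 y1 B" "kronecker_rep n x2 y2 C"
      and iso: "rep_iso n x y (rep_mat x y A) (rep_dsum x1 y1 x2 y2 B C)"
    for x1 y1 x2 y2 and B C :: "nat \<Rightarrow> 'a mat"
  proof -
    obtain P Q where PQ: "P \<in> carrier_mat x x" "Q \<in> carrier_mat y y" "invertible_mat P" "invertible_mat Q"
      and h: "\<forall>i<n. Q * rep_mat x y A i = rep_dsum x1 y1 x2 y2 B C i * P"
      using iso unfolding rep_iso_def by blast
    obtain P' where P': "P' \<in> carrier_mat x x" "P * P' = 1\<^sub>m x" "P' * P = 1\<^sub>m x"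
      using invertible_matE PQ by blast
    obtain Q' where Q': "Q' \<in> carrier_mat y y" "Q * Q' = 1\<^sub>m y" "Q' * Q = 1\<^sub>m y"
      using invertible_matE PQ by blast
    define E where "E = (block_proj x1 x2 :: 'a mat)"
    define G where "G = (block_proj y1 y2 :: 'a mat)"
    have E: "E \<in> carrier_mat x x" "E * E = E" and G: "G \<in> carrier_mat y y" "G * G = G"
      using d by (auto simp: E_def G_def block_proj_idem)
    define e where "e = P' * E * P"
    define g where "g = Q' * G * Q"
    have eg: "e \<in> carrier_mat x x" "g \<in> carrier_mat y y"
      using PQ P' Q' E G by (auto simp: e_def g_def)
    have "g * rep_mat x y A i = rep_mat x y A i * e" if i: "i < n" for i
    proof -
      let ?A = "rep_mat x y A i" and ?D = "rep_dsum x1 y1 x2 y2 B C i"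
      have A: "?A \<in> carrier_mat y x" by simp
      have D: "?D \<in> carrier_mat y x"
        using BC i d by (auto simp: rep_dsum_def kronecker_rep_def)
      have GD: "G * ?D = ?D * E"
        unfolding G_def E_def using BC i by (intro block_proj_dsum) (auto simp: kronecker_rep_def)
      show ?thesis
        unfolding e_def g_def using h i
        by (intro conj_intertwine[OF A D PQ(1) P'(1,2) PQ(2) Q'(1,3) E(1) G(1) _ GD]) auto
    qed
    then have k: "khom n x y A A (fun_mat e) (fun_mat g)"
      using eg by (intro khom_rep_mat) auto
    have ee: "e * e = e" "g * g = g" "P * e * P' = E" "Q * g * Q' = G"
      unfolding e_def g_def using conj_proj PQ P' Q' E G by blast+
    have "idem_m x (fun_mat e)" "idem_m y (fun_mat g)"
      using mm_fun_mat[OF eg(1) eg(1)] mm_fun_mat[OF eg(2) eg(2)] ee by (simp_all add: idem_m_def)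
    then consider "meq {..<x} {..<x} (fun_mat e) zero_m" "meq {..<y} {..<y} (fun_mat g) zero_m"
      | "meq {..<x} {..<x} (fun_mat e) one_m" "meq {..<y} {..<y} (fun_mat g) one_m"
      using t k unfolding idem_trivial_def by blast
    then show False
    proof cases
      case 1
      then have "e = 0\<^sub>m x x" "g = 0\<^sub>m y y"
        using eg meq_fun_mat meq_trans meq_sym fun_mat_zero zero_carrier_mat by metis+
      then have "E = 0\<^sub>m x x" "G = 0\<^sub>m y y" using ee PQ P' Q' by auto
      then show False using block_proj_zero d unfolding E_def G_def by (metis add_is_0 less_numeral_extra(3))
    next
      case 2
      then have "e = 1\<^sub>m x" "g = 1\<^sub>m y"
        using eg meq_fun_mat meq_trans meq_sym fun_mat_one one_carrier_mat by metis+
      then have "E = 1\<^sub>m x" "G = 1\<^sub>m y" using ee PQ P' Q' by auto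
      then show False using block_proj_one d unfolding E_def G_def by (metis add_is_0 less_numeral_extra(3))
    qed
  qed
  then show ?thesis using pos unfolding rep_indecomposable_def by blast
qed

lemma nonzero_entries_rep_mat: "nonzero_entries n x y (rep_mat x y A) = card (edges n x y A)"
  unfolding nonzero_entries_def edges_def by (intro arg_cong[of _ _ card]) (auto simp: rep_mat_def)

theorem mainTheorem1:
  fixes n :: nat and x y :: nat
  assumes "n \<ge> 1"
    and "positive_imaginary_root n (int x) (int y)"
  shows "\<exists>F :: nat \<Rightarrow> nat \<Rightarrow> 'a::field mat.
           (\<forall>j<n. kronecker_rep n x y (F j) \<and> tree_module n x y (F j)) \<and>
           (\<forall>j<n. \<forall>l<n. j \<noteq> l \<longrightarrow> \<not> rep_iso n x y (F j) (F l))"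
proof -
  \<comment> \<open>Being at most 1 but not 1, the integer value of the form is at most 0.\<close>
  have "(int x)^2 + (int y)^2 - int n * int x * int y \<le> 0" and nz: "x \<noteq> 0 \<or> y \<noteq> 0"
    using assms(2) by (auto simp: positive_imaginary_root_def kronecker_root_def)
  then have "int (x * x + y * y) \<le> int (n * x * y)" by (simp add: power2_eq_square)
  then have q: "x * x + y * y \<le> n * x * y" by linarith
  \<comment> \<open>If one coordinate were 0 the right side of \<open>q\<close> would vanish, and
    with it the other coordinate.\<close>
  then have pos: "0 < x" "0 < y" using nz by (auto intro: gr0I)
  have n: "2 \<le> n"
  proof (rule ccontr)
    assume "\<not> 2 \<le> n"
    with assms(1) have "n = 1" by simp
    with q have "x * x + y * y \<le> x * y" by simp
    \<comment> \<open>For n = 1 the form is positive definite, as x y is at most the larger of the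
      two squares.\<close>
    moreover have "x * y \<le> x * x \<or> x * y \<le> y * y" using mult_le_mono by (meson le_refl nat_le_linear)
    moreover have "0 < x * x" "0 < y * y" using pos by simp_all
    ultimately show False by linarith
  qed
  have "\<exists>F :: nat \<Rightarrow> nat \<Rightarrow> nat \<Rightarrow> nat \<Rightarrow> 'a. tree_family n x y F"
  proof (cases "x \<le> y")
    case True
    then show ?thesis using tree_family_exists[OF n pos(1) True q] by blast
  next
    case False
    then have "y \<le> x" "y * y + x * x \<le> n * y * x" using q by (simp_all add: mult_ac)
    then show ?thesis using tree_family_exists[OF n pos(2)] tree_family_transp by blast
  qed
  then obtain F :: "nat \<Rightarrow> nat \<Rightarrow> nat \<Rightarrow> nat \<Rightarrow> 'a" where F: "tree_family n x y F" ..
  define R where "R j = rep_mat x y (F j)" for j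
  have rep: "kronecker_rep n x y (R j)" for j
    by (simp add: R_def kronecker_rep_def)
  \<comment> \<open>The given bases already exhibit the tree, so the matrix representation required
    is \<open>R j\<close> itself.\<close>
  have "tree_module n x y (R j)" if "j < n" for j
    unfolding tree_module_def
    using rep[of j] rep_iso_refl[OF rep[of j]] F that pos idem_trivial_imp_indecomposable[of n x y "F j"]
    by (auto simp: R_def nonzero_entries_rep_mat tree_family_def intro!: exI[of _ "R j"])
  moreover have "\<not> rep_iso n x y (R j) (R l)" if "j < n" "l < n" "j \<noteq> l" for j l
    using F that rep_iso_imp_kiso[of n x y "F j" "F l"] by (auto simp: R_def tree_family_def)
  ultimately show ?thesis using rep by blast
qed

end
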